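(* Let $(K,v)$ be a valued field with value group $\Gamma_v$, let $\Lambda$ be a totally ordered abelian group containing the divisible hull $\Gamma_{\mathbb{Q}}=\Gamma_v\otimes_{\mathbb{Z}}\mathbb{Q}$, and let $\mathcal{T}=\mathcal{T}(v,\Lambda)$. For a valuation $\mu\in\mathcal{T}$ (for which some $\eta\in\mathcal{T}$ with $\mu\not\leq\eta$ exists, so that the class $\mathcal{B}_{\nleq}(\mu)$ is defined), we have $$\mathcal{T}_\mu={\rm TD}(\mu)\sqcup\{\mathcal{B}_{\nleq}(\mu)\}$$ as sets of subsets of $\mathcal{T}$.
   Context: A valuation on $K[x]$ is a map $\nu:K[x]\to\Lambda_\infty=\Lambda\cup\{\infty\}$ with $\nu(fg)=\nu(f)+\nu(g)$, $\nu(f+g)\geq\min\{\nu(f),\nu(g)\}$, $\nu(1)=0$, $\nu(0)=\infty$ (nonzero polynomials may have value $\infty$). $\mathcal{T}(v,\Lambda)$ is the set of valuations $\nu:K[x]\to\Lambda_\infty$ with $\nu|_K=v$, partially ordered by $\mu\leq\nu$ iff $\mu(f)\leq\nu(f)$ for all $f\in K[x]$. Known facts: each $(-\infty,\mu]=\{\nu\in\mathcal{T}\mid\nu\leq\mu\}$ is totally ordered, and any $\mu,\nu\in\mathcal{T}$ have an infimum $\mu\wedge\nu\in\mathcal{T}$. Interval: $[\mu,\nu]=\{\eta\in\mathcal{T}\mid\mu\wedge\nu\leq\eta\leq\mu\text{ or }\mu\wedge\nu\leq\eta\leq\nu\}$. For $\mu\in\mathcal{T}$, the equivalence relation $\sim_\mu$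 on $\mathcal{T}\setminus\{\mu\}$ is $\nu\sim_\mu\eta$ iff $\mu\notin[\nu,\eta]$; $[\nu]_\mu$ is the class of $\nu$ and $\mathcal{T}_\mu=\{[\nu]_\mu\mid\nu\in\mathcal{T}\setminus\{\mu\}\}$. On $\{\nu\in\mathcal{T}\mid\mu<\nu\}$ define the equivalence relation $\nu\sim_{\rm tan}\eta$ iff $(\mu,\nu]\cap(\mu,\eta]\neq\emptyset$, where $(\mu,\nu]=\{\rho\in\mathcal{T}\mid\mu<\rho\leq\nu\}$. ${\rm TD}(\mu)$ is the set of its equivalence classes (empty if $\mu$ is maximal). $\mathcal{B}_{\nleq}(\mu)=\{\rho\in\mathcal{T}\mid\mu\not\leq\rho\}$, which equals $[\eta]_\mu$ for any $\eta\in\mathcal{T}$ with $\mu\not\leq\eta$. *)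

theory Defs
  imports "HOL-Computational_Algebra.Polynomial"
begin

datatype 'a with_infty = Fin 'a | Infty

instantiation with_infty :: (linorder) linorder
begin

definition less_eq_with_infty :: "'a with_infty \<Rightarrow> 'a with_infty \<Rightarrow> bool" where
  "x \<le> y \<longleftrightarrow>
     (case y of Infty \<Rightarrow> True | Fin b \<Rightarrow> (case x of Infty \<Rightarrow> False | Fin a \<Rightarrow> a \<le> b))"

definition less_with_infty :: "'a with_infty \<Rightarrow> 'a with_infty \<Rightarrow> bool" where
  "x < y \<longleftrightarrow>
     (case x of Infty \<Rightarrow> False | Fin a \<Rightarrow> (case y of Infty \<Rightarrow> True | Fin b \<Rightarrow> a < b))"

instance
  by standard (auto simp: less_eq_with_infty_def less_with_infty_def split: with_infty.splits)

end

instantiation with_infty :: (comm_monoid_add) comm_monoid_add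
begin

definition zero_with_infty :: "'a with_infty" where
  "0 = Fin 0"

definition plus_with_infty :: "'a with_infty \<Rightarrow> 'a with_infty \<Rightarrow> 'a with_infty" where
  "x + y =
     (case x of Infty \<Rightarrow> Infty | Fin a \<Rightarrow> (case y of Infty \<Rightarrow> Infty | Fin b \<Rightarrow> Fin (a + b)))"

instance
  by standard (auto simp: zero_with_infty_def plus_with_infty_def ac_simps split: with_infty.splits)

end

text \<open>Nonzero elements may have value \<^term>\<open>Infty\<close>. On a field this cannot happen (see
  \<open>valuation_field_eq_Infty_iff\<close> below), so the same definition also covers valued fields.\<close>

definition valuation :: "('r::comm_ring_1 \<Rightarrow> 'l::linordered_ab_group_add with_infty) \<Rightarrow> bool" where
  "valuation \<nu> \<longleftrightarrow>
     (\<forall>f g. \<nu> (f * g) = \<nu> f + \<nu> g) \<and>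
     (\<forall>f g. min (\<nu> f) (\<nu> g) \<le> \<nu> (f + g)) \<and>
     \<nu> 1 = 0 \<and> \<nu> 0 = Infty"

lemma valuation_field_eq_Infty_iff:
  fixes v :: "'k::field \<Rightarrow> 'l::linordered_ab_group_add with_infty"
  assumes "valuation v"
  shows "v a = Infty \<longleftrightarrow> a = 0"
proof
  assume *: "v a = Infty"
  show "a = 0"
  proof (rule ccontr)
    assume "a \<noteq> 0"
    then have "v a + v (inverse a) = 0"
      using assms unfolding valuation_def by (metis right_inverse)
    with * show False
      by (simp add: plus_with_infty_def zero_with_infty_def)
  qed
qed (use assms in \<open>simp add: valuation_def\<close>)

definition value_group :: "('k::field \<Rightarrow> 'l::linordered_ab_group_add with_infty) \<Rightarrow> 'l set" where
  "value_group v = {\<gamma>. \<exists>a. a \<noteq> 0 \<and> v a = Fin \<gamma>}"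

text \<open>\<open>D\<close> is a copy of \<open>G \<otimes> \<rat>\<close> inside the (torsion-free) ambient group, compatible with the
  inclusion of \<open>G\<close>: a divisible subgroup containing \<open>G\<close>, every element of which has a positive
  multiple in \<open>G\<close>. The sum \<open>\<Sum>i<n. d\<close> is the multiple \<open>n d\<close>. There need not be such a \<open>D\<close>
  in the ambient group.\<close>

definition is_divisible_hull :: "'l::linordered_ab_group_add set \<Rightarrow> 'l set \<Rightarrow> bool" where
  "is_divisible_hull G D \<longleftrightarrow>
     0 \<in> D \<and> (\<forall>x\<in>D. \<forall>y\<in>D. x + y \<in> D) \<and> (\<forall>x\<in>D. - x \<in> D) \<and>
     G \<subseteq> D \<and>
     (\<forall>d\<in>D. \<forall>n::nat. n > 0 \<longrightarrow> (\<exists>e\<in>D. (\<Sum>i<n. e) = d)) \<and>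
     (\<forall>d\<in>D. \<exists>n::nat. n > 0 \<and> (\<Sum>i<n. d) \<in> G)"

text \<open>The partial order on valuations is the pointwise order that HOL provides on functions.\<close>

definition val_tree ::
  "('k::field \<Rightarrow> 'l::linordered_ab_group_add with_infty) \<Rightarrow> ('k poly \<Rightarrow> 'l with_infty) set" where
  "val_tree v = {\<nu>. valuation \<nu> \<and> (\<forall>a. \<nu> [:a:] = v a)}"

text \<open>In the following, \<open>T\<close> is a subset of an ordered type, regarded as a partially ordered set in
  its own right; in particular the infimum is taken among the elements of \<open>T\<close>.\<close>

definition inf_in :: "'a::order set \<Rightarrow> 'a \<Rightarrow> 'a \<Rightarrow> 'a" where
  "inf_in T \<mu> \<nu> =
     (THE \<rho>. \<rho> \<in> T \<and> \<rho> \<le> \<mu> \<and> \<rho> \<le> \<nu> \<and> (\<forall>\<eta>\<in>T. \<eta> \<le> \<mu> \<and> \<eta> \<le> \<nu> \<longrightarrow> \<eta> \<le> \<rho>))"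

definition tree_interval :: "'a::order set \<Rightarrow> 'a \<Rightarrow> 'a \<Rightarrow> 'a set" where
  "tree_interval T \<mu> \<nu> =
     {\<eta>\<in>T. (inf_in T \<mu> \<nu> \<le> \<eta> \<and> \<eta> \<le> \<mu>) \<or> (inf_in T \<mu> \<nu> \<le> \<eta> \<and> \<eta> \<le> \<nu>)}"

definition sim_rel :: "'a::order set \<Rightarrow> 'a \<Rightarrow> ('a \<times> 'a) set" where
  "sim_rel T \<mu> = {(\<nu>, \<eta>). \<nu> \<in> T - {\<mu>} \<and> \<eta> \<in> T - {\<mu>} \<and> \<mu> \<notin> tree_interval T \<nu> \<eta>}"

definition sim_classes :: "'a::order set \<Rightarrow> 'a \<Rightarrow> 'a set set" where
  "sim_classes T \<mu> = (T - {\<mu>}) // sim_rel T \<mu>"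

definition left_open_interval :: "'a::order set \<Rightarrow> 'a \<Rightarrow> 'a \<Rightarrow> 'a set" where
  "left_open_interval T \<mu> \<nu> = {\<rho>\<in>T. \<mu> < \<rho> \<and> \<rho> \<le> \<nu>}"

definition tan_rel :: "'a::order set \<Rightarrow> 'a \<Rightarrow> ('a \<times> 'a) set" where
  "tan_rel T \<mu> =
     {(\<nu>, \<eta>). \<nu> \<in> T \<and> \<mu> < \<nu> \<and> \<eta> \<in> T \<and> \<mu> < \<eta> \<and>
       left_open_interval T \<mu> \<nu> \<inter> left_open_interval T \<mu> \<eta> \<noteq> {}}"

definition tangent_directions :: "'a::order set \<Rightarrow> 'a \<Rightarrow> 'a set set" where
  "tangent_directions T \<mu> = {\<nu>\<in>T. \<mu> < \<nu>} // tan_rel T \<mu>"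

definition not_above :: "'a::order set \<Rightarrow> 'a \<Rightarrow> 'a set" where
  "not_above T \<mu> = {\<rho>\<in>T. \<not> \<mu> \<le> \<rho>}"

end

(* The statement is formal once T is known to be a meet-semilattice in which each lower set
   (-oo, mu] is a chain: for nu, eta above mu one has mu \<notin> [nu, eta] iff mu < nu \<and> eta, the
   elements not above mu are pairwise equivalent, and none of them is equivalent to an element
   above mu. For both order properties, let phi have least degree among the polynomials on which
   mu and nu differ, say mu phi < nu phi. Then the truncation
   (\<Sum> a_i phi^i) |-> min (mu a_i + i * mu phi) is a valuation, and it is the meet of mu and nu. *)

theory Submission
  imports Defs
begin

section \<open>Arithmetic of values with infinity\<close>

instance with_infty :: (linordered_ab_group_add) ordered_comm_monoid_add
  by standard (auto simp: less_eq_with_infty_def plus_with_infty_def split: with_infty.splits)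

lemma with_infty_add_strict_left_mono:
  fixes a b c :: "'l::linordered_ab_group_add with_infty"
  assumes "a < b" and "c \<noteq> Infty"
  shows "c + a < c + b"
  using assms by (auto simp: less_with_infty_def plus_with_infty_def split: with_infty.splits)

lemma Infty_add [simp]: "Infty + a = Infty" "a + Infty = Infty"
  by (auto simp: plus_with_infty_def split: with_infty.splits)

lemma le_Infty [simp]: "(a :: 'l::linorder with_infty) \<le> Infty"
  by (simp add: less_eq_with_infty_def)

lemma less_imp_ne_Infty: "(a :: 'l::linorder with_infty) < b \<Longrightarrow> a \<noteq> Infty"
  by (auto simp: less_with_infty_def)

lemma with_infty_double_eq_0:
  fixes a :: "'l::linordered_ab_group_add with_infty"
  assumes "a + a = 0"
  shows "a = 0"
  using assms by (auto simp: plus_with_infty_def zero_with_infty_def split: with_infty.splits)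

lemma with_infty_add_left_min:
  fixes a b c :: "'l::linordered_ab_group_add with_infty"
  shows "c + min a b = min (c + a) (c + b)"
  by (simp add: min_def add_left_mono) (metis add_left_mono antisym linear)

section \<open>Valuations: signs and sums of unequal values\<close>

lemma valuation_mult: "valuation \<nu> \<Longrightarrow> \<nu> (f * g) = \<nu> f + \<nu> g"
  and valuation_add: "valuation \<nu> \<Longrightarrow> min (\<nu> f) (\<nu> g) \<le> \<nu> (f + g)"
  and valuation_one: "valuation \<nu> \<Longrightarrow> \<nu> 1 = 0"
  and valuation_zero: "valuation \<nu> \<Longrightarrow> \<nu> 0 = Infty"
  by (auto simp: valuation_def)

lemma valuation_minus:
  assumes "valuation \<nu>"
  shows "\<nu> (- f) = \<nu> f"
proof -
  have "\<nu> (- 1) + \<nu> (- 1) = 0"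
    using valuation_mult[OF assms, of "-1" "-1"] valuation_one[OF assms] by simp
  then have "\<nu> (- 1) = 0"
    by (rule with_infty_double_eq_0)
  then show ?thesis
    using valuation_mult[OF assms, of "-1" f] by simp
qed

text \<open>Since f = (f + g) + (- g), a value of f + g above \<open>\<nu> f\<close> would push
  \<open>\<nu> f\<close> above itself.\<close>

lemma valuation_add_eq:
  assumes "valuation \<nu>" and "\<nu> f < \<nu> g"
  shows "\<nu> (f + g) = \<nu> f"
proof -
  have "min (\<nu> (f + g)) (\<nu> (- g)) \<le> \<nu> f"
    using valuation_add[OF assms(1), of "f + g" "- g"] by simp
  then show ?thesis
    using valuation_add[OF assms(1), of f g] assms(2) valuation_minus[OF assms(1), of g]
    by (auto simp: min_def split: if_splits)
qed

lemma valuation_add_eq_min: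
  assumes "valuation \<nu>" and "\<nu> f \<noteq> \<nu> g"
  shows "\<nu> (f + g) = min (\<nu> f) (\<nu> g)"
  using valuation_add_eq[OF assms(1), of f g] valuation_add_eq[OF assms(1), of g f] assms(2)
  by (cases "\<nu> f < \<nu> g") (auto simp: add.commute min_def)

section \<open>Degrees under division with remainder\<close>

lemma degree_div_add:
  fixes f \<phi> :: "'k::field poly"
  assumes "f div \<phi> \<noteq> 0"
  shows "degree (f div \<phi>) + degree \<phi> = degree f"
proof -
  have "\<phi> \<noteq> 0"
    using assms by auto
  then have deg: "degree (f div \<phi> * \<phi>) = degree (f div \<phi>) + degree \<phi>"
    using assms by (simp add: degree_mult_eq)
  show ?thesis
  proof (cases "f mod \<phi> = 0")
    case True
    then show ?thesis
      using deg div_mult_mod_eq[of f \<phi>] by simp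
  next
    case False
    then have "degree (f mod \<phi>) < degree (f div \<phi> * \<phi>)"
      using degree_mod_less'[OF \<open>\<phi> \<noteq> 0\<close> False] deg by simp
    then show ?thesis
      using degree_add_eq_left deg div_mult_mod_eq[of f \<phi>] by metis
  qed
qed

lemma degree_div_less_self:
  fixes f \<phi> :: "'k::field poly"
  assumes "degree \<phi> > 0" and "degree f \<ge> degree \<phi>"
  shows "degree (f div \<phi>) < degree f"
  using assms degree_div_add[of f \<phi>] by (cases "f div \<phi> = 0") auto

text \<open>The product has degree below twice \<open>degree \<phi>\<close>, so its
  \<open>\<phi>\<close>-expansion consists of a remainder and a single carry.\<close>

lemma degree_mult_div_less:
  fixes a b \<phi> :: "'k::field poly"
  assumes "degree a < degree \<phi>" and "degree b < degree \<phi>"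
  shows "degree (a * b div \<phi>) < degree \<phi>"
  using assms degree_mult_le[of a b] degree_div_add[of "a * b" \<phi>]
  by (cases "a * b div \<phi> = 0") auto

section \<open>Truncation of a valuation along \<open>\<phi>\<close>-expansions\<close>

text \<open>Horner form of the minimum over the \<open>\<phi>\<close>-expansion. The value for
  constant \<open>\<phi>\<close> is a default that secures termination.\<close>

function truncation ::
  "('k::field poly \<Rightarrow> 'l::linordered_ab_group_add with_infty) \<Rightarrow> 'k poly \<Rightarrow> 'k poly \<Rightarrow> 'l with_infty"
  where
  "truncation \<mu> \<phi> f =
     (if degree \<phi> = 0 \<or> degree f < degree \<phi> then \<mu> f
      else min (\<mu> (f mod \<phi>)) (\<mu> \<phi> + truncation \<mu> \<phi> (f div \<phi>)))"
  by pat_completeness auto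
termination
  by (relation "measure (\<lambda>(\<mu>, \<phi>, f). degree f)") (auto intro: degree_div_less_self)

declare truncation.simps [simp del]

lemma truncation_below: "degree f < degree \<phi> \<Longrightarrow> truncation \<mu> \<phi> f = \<mu> f"
  by (simp add: truncation.simps)

text \<open>\<open>\<phi>\<close> has least degree among the polynomials on which the valuations
  differ. The order between \<open>\<mu>\<close> and \<open>\<nu>\<close> is left open, so the
  setting serves both the meet of incomparable valuations and the comparison of valuations below a
  third one.\<close>

locale separating_polynomial =
  fixes \<mu> \<nu> :: "'k::field poly \<Rightarrow> 'l::linordered_ab_group_add with_infty" and \<phi> :: "'k poly"
  assumes \<mu>: "valuation \<mu>" and \<nu>: "valuation \<nu>"
    and degree_pos: "degree \<phi> > 0"
    and below: "\<And>f. degree f < degree \<phi> \<Longrightarrow> \<mu> f = \<nu> f"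
    and value_less: "\<mu> \<phi> < \<nu> \<phi>"
begin

abbreviation "\<rho> \<equiv> truncation \<mu> \<phi>"

lemma degree_mod_less_\<phi>: "degree (f mod \<phi>) < degree \<phi>"
  using degree_mod_less[of \<phi> f] degree_pos by (cases "\<phi> = 0") auto

text \<open>For f of small degree the quotient is 0, whose value \<open>Infty\<close> drops out of
  the minimum; the recursion then needs no case distinction.\<close>

lemma truncation_rec: "\<rho> f = min (\<mu> (f mod \<phi>)) (\<mu> \<phi> + \<rho> (f div \<phi>))"
proof (cases "degree f < degree \<phi>")
  case True
  then show ?thesis
    using degree_pos by (simp add: truncation_below div_poly_less mod_poly_less valuation_zero \<mu>)
next
  case False
  then show ?thesis
    using degree_pos by (subst truncation.simps) simp
qed

text \<open>The guard matters: a polynomial of degree 0 has quotient 0, which is again of degree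
  0.\<close>

lemma quotient_induct [case_names less]:
  assumes "\<And>f. (degree f \<ge> degree \<phi> \<Longrightarrow> P (f div \<phi>)) \<Longrightarrow> P f"
  shows "P f"
proof (induction "degree f" arbitrary: f rule: less_induct)
  case less
  then show ?case
    using assms degree_div_less_self[OF degree_pos] by blast
qed

text \<open>The bounds on the coefficients and on \<open>\<phi>\<close> bound every term of the
  \<open>\<phi>\<close>-expansion, and \<open>\<kappa> f\<close> is at least the minimum over the
  terms.\<close>

lemma truncation_le:
  assumes \<kappa>: "valuation \<kappa>" and le: "\<And>f. degree f < degree \<phi> \<Longrightarrow> \<mu> f \<le> \<kappa> f"
    and le_\<phi>: "\<mu> \<phi> \<le> \<kappa> \<phi>"
  shows "\<rho> f \<le> \<kappa> f"
proof (induction f rule: quotient_induct)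
  case (less f)
  show ?case
  proof (cases "degree f < degree \<phi>")
    case True
    then show ?thesis by (simp add: truncation_below le)
  next
    case False
    have "\<rho> f \<le> min (\<kappa> (f mod \<phi>)) (\<kappa> (\<phi> * (f div \<phi>)))"
      unfolding truncation_rec[of f] valuation_mult[OF \<kappa>]
      using False by (intro min.mono le degree_mod_less_\<phi> add_mono le_\<phi> less) auto
    also have "\<dots> \<le> \<kappa> (f mod \<phi> + \<phi> * (f div \<phi>))"
      by (rule valuation_add[OF \<kappa>])
    finally show ?thesis by simp
  qed
qed

lemma truncation_le_left: "\<rho> f \<le> \<mu> f"
  by (rule truncation_le) (use \<mu> in auto)

lemma truncation_le_right: "\<rho> f \<le> \<nu> f"
  by (rule truncation_le) (use \<nu> below value_less in auto)

text \<open>Remainder and quotient by \<open>\<phi>\<close> are additive, so the inequality is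
  inherited from \<open>\<mu>\<close> term by term.\<close>

lemma truncation_add: "min (\<rho> f) (\<rho> g) \<le> \<rho> (f + g)"
proof (induction "degree f + degree g" arbitrary: f g rule: less_induct)
  case less
  show ?case
  proof (cases "degree f < degree \<phi> \<and> degree g < degree \<phi>")
    case True
    then show ?thesis
      by (simp add: truncation_below degree_add_less valuation_add \<mu>)
  next
    case False
    have dec: "degree (h div \<phi>) \<le> degree h" "degree h \<ge> degree \<phi> \<Longrightarrow> degree (h div \<phi>) < degree h"
      for h using degree_pos degree_div_less_self[of \<phi> h] degree_div_add[of h \<phi>]
      by (cases "h div \<phi> = 0"; auto)+
    \<comment> \<open>Only one of the two degrees is sure to drop, hence the induction on their
      sum.\<close>
    have "degree (f div \<phi>) + degree (g div \<phi>) < degree f + degree g"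
      using False dec[of f] dec[of g] by linarith
    note IH = less[OF this]
    have "min (\<rho> f) (\<rho> g) =
      min (min (\<mu> (f mod \<phi>)) (\<mu> (g mod \<phi>))) (\<mu> \<phi> + min (\<rho> (f div \<phi>)) (\<rho> (g div \<phi>)))"
      unfolding truncation_rec[of f] truncation_rec[of g] with_infty_add_left_min
      by (simp add: ac_simps)
    also have "\<dots> \<le> min (\<mu> (f mod \<phi> + g mod \<phi>)) (\<mu> \<phi> + \<rho> (f div \<phi> + g div \<phi>))"
      by (intro min.mono valuation_add \<mu> add_left_mono IH)
    also have "\<dots> = \<rho> (f + g)"
      by (subst truncation_rec[of "f + g"]) (simp add: poly_mod_add_left poly_div_add_left)
    finally show ?thesis .
  qed
qed

lemma truncation_minus: "\<rho> (- f) = \<rho> f"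
proof (induction f rule: quotient_induct)
  case (less f)
  show ?case
  proof (cases "degree f < degree \<phi>")
    case True
    then show ?thesis by (simp add: truncation_below valuation_minus \<mu>)
  next
    case False
    then show ?thesis
      using less truncation_rec[of f] truncation_rec[of "- f"]
      by (simp add: poly_mod_minus_left poly_div_minus_left valuation_minus \<mu>)
  qed
qed

text \<open>Same argument as for valuations; \<open>\<rho>\<close> is not yet known to be
  one.\<close>

lemma truncation_add_eq:
  assumes "\<rho> f < \<rho> g"
  shows "\<rho> (f + g) = \<rho> f"
  using truncation_add[of "f + g" "- g"] truncation_add[of f g] assms truncation_minus[of g]
  by (auto simp: min_def split: if_splits)

lemma truncation_mult_\<phi>: "\<rho> (\<phi> * f) = \<mu> \<phi> + \<rho> f"
  using truncation_rec[of "\<phi> * f"] degree_pos by (auto simp: valuation_zero \<mu>)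

text \<open>Here \<open>\<mu> \<phi> < \<nu> \<phi>\<close> enters: a cancellation between remainder and quotient part under
  \<open>\<mu>\<close> would be invisible to \<open>\<nu>\<close>, whereas both valuations agree on the product.\<close>
lemma mult_mod_div:
  assumes a: "degree a < degree \<phi>" and b: "degree b < degree \<phi>"
  shows "\<mu> (a * b mod \<phi>) = \<mu> a + \<mu> b" and "\<mu> a + \<mu> b \<le> \<mu> \<phi> + \<mu> (a * b div \<phi>)"
proof -
  let ?c = "a * b mod \<phi>" and ?e = "a * b div \<phi>"
  have e: "degree ?e < degree \<phi>"
    using a b by (rule degree_mult_div_less)
  have ab: "\<nu> (a * b) = \<mu> (a * b)"
    using a b by (simp add: valuation_mult \<mu> \<nu> below)
  have c: "\<nu> ?c = \<mu> ?c"
    by (simp add: below degree_mod_less_\<phi>)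
  have split: "a * b = ?c + \<phi> * ?e"
    by simp
  have m: "\<mu> (\<phi> * ?e) = \<mu> \<phi> + \<mu> ?e" and n: "\<nu> (\<phi> * ?e) = \<nu> \<phi> + \<mu> ?e"
    by (simp_all add: valuation_mult \<mu> \<nu> below e)
  have strict: "\<mu> ?e \<noteq> Infty \<Longrightarrow> \<mu> (\<phi> * ?e) < \<nu> (\<phi> * ?e)"
    unfolding m n add.commute[of _ "\<mu> ?e"] by (rule with_infty_add_strict_left_mono[OF value_less])
  have ge: "\<mu> (a * b) \<le> \<mu> \<phi> + \<mu> ?e"
  proof (rule ccontr)
    assume *: "\<not> ?thesis"
    then have fin: "\<mu> ?e \<noteq> Infty"
      by auto
    \<comment> \<open>With different values, \<open>\<mu> (a * b)\<close> would be their minimum,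
      hence at most \<open>\<mu> (\<phi> * ?e)\<close>.\<close>
    have "\<mu> ?c = \<mu> (\<phi> * ?e)"
      using * valuation_add_eq_min[OF \<mu>, of ?c "\<phi> * ?e"] split m
      by (metis linear min.cobounded2)
    then have "\<nu> (?c + \<phi> * ?e) = \<mu> ?c"
      using valuation_add_eq[OF \<nu>, of ?c "\<phi> * ?e"] c strict[OF fin] by simp
    then show False
      using * ab split m \<open>\<mu> ?c = \<mu> (\<phi> * ?e)\<close> by simp
  qed
  show "\<mu> a + \<mu> b \<le> \<mu> \<phi> + \<mu> ?e"
    using ge by (simp add: valuation_mult \<mu>)
  have "\<mu> ?c = \<mu> (a * b)"
  \<comment> \<open>The strict inequality needs a finite value of the carry. With an infinite one,
    \<open>\<phi> * ?e\<close> does not affect \<open>\<mu>\<close> at all.\<close>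
  proof (cases "\<mu> ?e = Infty")
    case True
    have "\<mu> (\<phi> * ?e) = Infty"
      using True m by simp
    then show ?thesis
      using valuation_add_eq_min[OF \<mu>, of ?c "\<phi> * ?e"] split
      by (metis le_Infty min.absorb1 min.idem valuation_add[OF \<mu>] antisym)
  next
    case False
    have "\<nu> (a * b) < \<nu> (- (\<phi> * ?e))"
      using ab ge m strict[OF False] valuation_minus[OF \<nu>, of "\<phi> * ?e"] by simp
    then have "\<nu> (a * b + - (\<phi> * ?e)) = \<nu> (a * b)"
      by (rule valuation_add_eq[OF \<nu>])
    then show ?thesis
      using ab c by (simp add: minus_mult_div_eq_mod)
  qed
  then show "\<mu> ?c = \<mu> a + \<mu> b"
    by (simp add: valuation_mult \<mu>)
qed

text \<open>Multiplying a coefficient by a produces a carry into the next one; by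
  \<open>mult_mod_div\<close> the carry is too large in value to lower the minimum.\<close>

lemma truncation_mult_below:
  assumes a: "degree a < degree \<phi>"
  shows "\<rho> (a * f) = \<mu> a + \<rho> f"
proof (induction f rule: quotient_induct)
  case (less f)
  let ?b = "f mod \<phi>" and ?q = "f div \<phi>"
  let ?c = "a * ?b mod \<phi>" and ?e = "a * ?b div \<phi>"
  have IH: "\<rho> (a * ?q) = \<mu> a + \<rho> ?q"
    using less degree_pos
    by (cases "degree f < degree \<phi>") (auto simp: div_poly_less truncation_below valuation_zero \<mu>)
  note c = mult_mod_div[OF a degree_mod_less_\<phi>, of f]
  have e: "degree ?e < degree \<phi>"
    using a degree_mod_less_\<phi> by (rule degree_mult_div_less)
  have "a * f = a * ?b + \<phi> * (a * ?q)"
    by (metis distrib_left mod_mult_div_eq mult.left_commute)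
  then have "a * f mod \<phi> = ?c" and "a * f div \<phi> = ?e + a * ?q"
    using degree_pos by (auto simp: poly_mod_add_left poly_div_add_left)
  then have rec: "\<rho> (a * f) = min (\<mu> a + \<mu> ?b) (\<mu> \<phi> + \<rho> (?e + a * ?q))"
    using truncation_rec[of "a * f"] c by simp
  have target: "\<mu> a + \<rho> f = min (\<mu> a + \<mu> ?b) (\<mu> \<phi> + (\<mu> a + \<rho> ?q))"
    by (subst truncation_rec[of f]) (simp add: with_infty_add_left_min ac_simps)
  show ?case
  \<comment> \<open>If the constant term attains the minimum, the carry only has to respect it;
    otherwise the carry lies strictly above \<open>a * ?q\<close> and is absorbed.\<close>
  proof (cases "\<mu> a + \<mu> ?b \<le> \<mu> \<phi> + (\<mu> a + \<rho> ?q)")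
    case True
    have "\<mu> a + \<mu> ?b \<le> \<mu> \<phi> + min (\<rho> ?e) (\<rho> (a * ?q))"
      using True c(2) by (simp add: with_infty_add_left_min IH truncation_below e)
    also have "\<dots> \<le> \<mu> \<phi> + \<rho> (?e + a * ?q)"
      by (intro add_left_mono truncation_add)
    finally show ?thesis
      using True by (simp add: rec target min_absorb1)
  next
    case False
    then have "\<mu> \<phi> + (\<mu> a + \<rho> ?q) < \<mu> \<phi> + \<mu> ?e"
      using c(2) by simp
    then have "\<rho> (a * ?q) < \<rho> ?e"
      unfolding IH truncation_below[OF e] using add_left_mono leD not_le by blast
    then have "\<rho> (?e + a * ?q) = \<mu> a + \<rho> ?q"
      using truncation_add_eq[of "a * ?q" ?e] IH by (simp add: add.commute)
    then show ?thesis
      by (simp add: rec target)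
  qed
qed

text \<open>Multiplication by \<open>\<phi>\<close> and by a remainder is already exact; expanding f
  reduces the claim to these and to its quotient.\<close>

lemma truncation_mult_le:
  "\<rho> f + \<rho> g \<le> \<rho> (f * g)"
proof (induction f rule: quotient_induct)
  case (less f)
  let ?a = "f mod \<phi>" and ?q = "f div \<phi>"
  have IH: "\<rho> ?q + \<rho> g \<le> \<rho> (?q * g)"
    using less degree_pos
    by (cases "degree f < degree \<phi>") (auto simp: div_poly_less truncation_below valuation_zero \<mu>)
  have "\<rho> f + \<rho> g = min (\<mu> ?a + \<rho> g) (\<mu> \<phi> + (\<rho> ?q + \<rho> g))"
    by (subst truncation_rec[of f]) (simp add: add.commute[of _ "\<rho> g"] with_infty_add_left_min ac_simps)
  also have "\<dots> \<le> min (\<rho> (?a * g)) (\<rho> (\<phi> * (?q * g)))"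
    by (intro min.mono) (simp_all add: truncation_mult_below degree_mod_less_\<phi> truncation_mult_\<phi> IH add_left_mono)
  also have "\<dots> \<le> \<rho> (?a * g + \<phi> * (?q * g))"
    by (rule truncation_add)
  also have "?a * g + \<phi> * (?q * g) = f * g"
    by (metis distrib_right mod_mult_div_eq mult.assoc)
  finally show ?case .
qed

text \<open>One may assume that both factors attain their minimum at the constant term of the
  \<open>\<phi>\<close>-expansion, since otherwise the constant term is negligible and \<open>\<phi>\<close> can be
  split off. In that case the constant term of the product has the expected value.\<close>
lemma truncation_mult: "\<rho> (f * g) = \<rho> f + \<rho> g"
proof (induction "degree f + degree g" arbitrary: f g rule: less_induct)
  case less
  \<comment> \<open>Stated for arbitrary factors, so that commutativity gives the case where g is
    split instead.\<close>
  have reduce: "\<rho> (f * g) = \<rho> f + \<rho> g"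
    if IH: "\<rho> ((f div \<phi>) * g) = \<rho> (f div \<phi>) + \<rho> g"
      and lt: "\<mu> \<phi> + \<rho> (f div \<phi>) < \<mu> (f mod \<phi>)" for f g
  proof (cases "\<rho> g = Infty")
    case True
    then show ?thesis
      using truncation_mult_le[of f g] le_Infty[of "\<rho> (f * g)"] by auto
  next
    case False
    have "\<rho> (\<phi> * ((f div \<phi>) * g)) < \<rho> ((f mod \<phi>) * g)"
      unfolding truncation_mult_\<phi> truncation_mult_below[OF degree_mod_less_\<phi>] IH
      using with_infty_add_strict_left_mono[OF lt False] by (simp add: ac_simps)
    from truncation_add_eq[OF this]
    have "\<rho> (\<phi> * ((f div \<phi>) * g) + (f mod \<phi>) * g) = \<mu> \<phi> + \<rho> (f div \<phi>) + \<rho> g"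
      unfolding truncation_mult_\<phi> IH by (simp add: add.assoc)
    moreover have "\<phi> * ((f div \<phi>) * g) + (f mod \<phi>) * g = f * g"
      by (metis distrib_right mult_div_mod_eq mult.assoc)
    moreover have "\<rho> f = \<mu> \<phi> + \<rho> (f div \<phi>)"
      using lt by (subst truncation_rec) simp
    ultimately show ?thesis by simp
  qed
  \<comment> \<open>For small f the quotient is 0 and the left-hand value is \<open>Infty\<close>,
    which is below nothing; so the induction really descends.\<close>
  have large: "degree f \<ge> degree \<phi>" if "\<mu> \<phi> + \<rho> (f div \<phi>) < \<mu> (f mod \<phi>)" for f
    using that degree_pos
    by (cases "degree f < degree \<phi>") (auto simp: div_poly_less truncation_below valuation_zero \<mu> less_with_infty_def)
  consider "\<mu> \<phi> + \<rho> (f div \<phi>) < \<mu> (f mod \<phi>)" | "\<mu> \<phi> + \<rho> (g div \<phi>) < \<mu> (g mod \<phi>)"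
    | "\<rho> f = \<mu> (f mod \<phi>)" "\<rho> g = \<mu> (g mod \<phi>)"
    using truncation_rec[of f] truncation_rec[of g] by (metis min.absorb1 not_le)
  then show ?case
  proof cases
    case 1
    with less[of "f div \<phi>" g] show ?thesis
      using degree_div_less_self[OF degree_pos large] by (auto intro: reduce)
  next
    case 2
    with less[of "g div \<phi>" f] show ?thesis
      using degree_div_less_self[OF degree_pos large] reduce[of g f] by (simp add: ac_simps)
  next
    case 3
    have "\<rho> (f * g) \<le> \<mu> (f * g mod \<phi>)"
      by (subst truncation_rec) simp
    also have "f * g mod \<phi> = (f mod \<phi>) * (g mod \<phi>) mod \<phi>"
      by (simp add: mod_mult_eq)
    also have "\<mu> \<dots> = \<rho> f + \<rho> g"
      using mult_mod_div(1)[OF degree_mod_less_\<phi> degree_mod_less_\<phi>, of f g] 3 by simp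
    finally show ?thesis
      using truncation_mult_le[of f g] by simp
  qed
qed

lemma valuation_truncation: "valuation \<rho>"
  unfolding valuation_def
  using truncation_mult truncation_add degree_pos \<mu>
  by (simp add: truncation_below valuation_one valuation_zero)

text \<open>This is only maximality among the common lower bounds; it becomes greatestness once
  lower sets are known to be chains.\<close>

lemma truncation_maximal:
  assumes \<eta>: "valuation \<eta>" and "\<rho> \<le> \<eta>" and "\<eta> \<le> \<mu>" and "\<eta> \<le> \<nu>"
  shows "\<eta> = \<rho>"
proof
  fix f
  have le: "\<rho> f \<le> \<eta> f" "\<eta> f \<le> \<mu> f" "\<eta> f \<le> \<nu> f" for f
    using assms by (auto simp: le_fun_def)
  \<comment> \<open>On the building blocks of \<open>\<phi>\<close>-expansions,
    \<open>\<eta>\<close> is squeezed between \<open>\<rho>\<close> and \<open>\<mu>\<close>, which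
    agree there.\<close>
  have eq_below: "\<eta> f = \<mu> f" if "degree f < degree \<phi>" for f
    using le[of f] truncation_below[OF that, of \<mu>] by simp
  have "\<rho> \<phi> = \<mu> \<phi>"
    using truncation_mult_\<phi>[of 1] degree_pos by (simp add: truncation_below valuation_one \<mu>)
  then have eq_\<phi>: "\<eta> \<phi> = \<mu> \<phi>"
    using le[of \<phi>] by simp
  show "\<eta> f = \<rho> f"
  proof (induction f rule: quotient_induct)
    case (less f)
    show ?case
    proof (cases "degree f < degree \<phi>")
      case True
      then show ?thesis by (simp add: eq_below truncation_below)
    next
      case False
      let ?a = "f mod \<phi>" and ?q = "f div \<phi>"
      have q: "\<eta> ?q = \<rho> ?q"
        using less False by simp
      have a: "\<eta> ?a = \<mu> ?a" "\<nu> ?a = \<mu> ?a"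
        by (simp_all add: eq_below below degree_mod_less_\<phi>)
      have rec: "\<rho> f = min (\<eta> ?a) (\<eta> (\<phi> * ?q))"
        by (subst truncation_rec) (simp add: valuation_mult \<eta> a q eq_\<phi>)
      show ?thesis
      proof (rule ccontr)
        assume "\<eta> f \<noteq> \<rho> f"
        then have lt: "\<rho> f < \<eta> f"
          using le[of f] by simp
        \<comment> \<open>A value above the minimum requires cancellation, hence two parts of equal
          value.\<close>
        have eq: "\<eta> ?a = \<eta> (\<phi> * ?q)"
        proof (rule ccontr)
          assume "\<eta> ?a \<noteq> \<eta> (\<phi> * ?q)"
          then have "\<eta> (?a + \<phi> * ?q) = \<rho> f"
            unfolding rec by (rule valuation_add_eq_min[OF \<eta>])
          with lt show False by simp
        qed
        then have fin: "\<rho> f = \<mu> ?a" "\<rho> f = \<mu> \<phi> + \<rho> ?q" "\<rho> ?q \<noteq> Infty"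
          using rec lt a less_imp_ne_Infty[OF lt] by (auto simp: valuation_mult \<eta> q eq_\<phi>)
        \<comment> \<open>Passing from \<open>\<mu> \<phi>\<close> to \<open>\<nu> \<phi>\<close>
          lifts the quotient part strictly, so nothing cancels under \<open>\<nu>\<close>: this
          gives \<open>\<nu> f = \<rho> f < \<eta> f\<close>, against
          \<open>\<eta> \<le> \<nu>\<close>.\<close>
        have "\<rho> f < \<nu> \<phi> + \<rho> ?q"
          unfolding fin(2) using with_infty_add_strict_left_mono[OF value_less fin(3)]
          by (simp add: add.commute)
        also have "\<dots> \<le> \<nu> (\<phi> * ?q)"
          unfolding valuation_mult[OF \<nu>] by (intro add_left_mono truncation_le_right)
        finally have "\<nu> ?a < \<nu> (\<phi> * ?q)"
          using fin a by simp
        then have "\<nu> f = \<rho> f"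
          using valuation_add_eq[OF \<nu>, of ?a "\<phi> * ?q"] fin a by simp
        then show False
          using lt le[of f] by simp
      qed
    qed
  qed
qed

lemma truncation_eq_if_le:
  assumes "\<mu> \<le> \<nu>"
  shows "\<rho> = \<mu>"
  using truncation_maximal[of \<mu>] assms \<mu> truncation_le_left by (simp add: le_fun_def)

end

section \<open>Lower sets and meets in the tree of valuations\<close>

lemma val_tree_separating_polynomial:
  assumes "\<mu> \<in> val_tree v" and "\<nu> \<in> val_tree v" and "\<mu> \<noteq> \<nu>"
  obtains \<phi> where "separating_polynomial \<mu> \<nu> \<phi>" | \<phi> where "separating_polynomial \<nu> \<mu> \<phi>"
proof -
  have "\<exists>f. \<mu> f \<noteq> \<nu> f"
    using assms(3) by auto
  then obtain \<phi> where \<phi>: "\<mu> \<phi> \<noteq> \<nu> \<phi>" and least: "\<And>f. \<mu> f \<noteq> \<nu> f \<Longrightarrow> degree \<phi> \<le> degree f"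
    using ex_has_least_nat[of "\<lambda>f. \<mu> f \<noteq> \<nu> f" _ degree] by metis
  \<comment> \<open>Both valuations restrict to v, so they cannot differ on a constant.\<close>
  have "degree \<phi> \<noteq> 0"
  proof
    assume "degree \<phi> = 0"
    then obtain a where "\<phi> = [:a:]"
      by (rule degree_eq_zeroE)
    then show False
      using \<phi> assms by (simp add: val_tree_def)
  qed
  moreover have "\<mu> f = \<nu> f" if "degree f < degree \<phi>" for f
    using least[of f] that by auto
  moreover have "valuation \<mu>" "valuation \<nu>"
    using assms by (auto simp: val_tree_def)
  ultimately have "\<mu> \<phi> < \<nu> \<phi> \<Longrightarrow> separating_polynomial \<mu> \<nu> \<phi>"
    "\<nu> \<phi> < \<mu> \<phi> \<Longrightarrow> separating_polynomial \<nu> \<mu> \<phi>"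
    by (simp_all add: separating_polynomial_def)
  then show thesis
    using \<phi> that linorder_cases[of "\<mu> \<phi>" "\<nu> \<phi>"] by blast
qed

lemma val_tree_separating_polynomial_le:
  assumes "\<mu> \<in> val_tree v" and "\<nu> \<in> val_tree v" and "\<mu> \<noteq> \<nu>" and "\<mu> \<le> \<nu>"
  obtains \<phi> where "separating_polynomial \<mu> \<nu> \<phi>"
  using val_tree_separating_polynomial[OF assms(1-3)] separating_polynomial.value_less assms(4)
  by (metis le_funD leD)

text \<open>Separate both valuations from \<open>\<nu>\<close> and keep the polynomial of smaller
  degree: below that degree all three agree, so its values alone decide the order.\<close>

lemma val_tree_lower_comparable:
  assumes T: "\<mu> \<in> val_tree v" "\<kappa> \<in> val_tree v" "\<nu> \<in> val_tree v"
    and le: "\<mu> \<le> \<nu>" "\<kappa> \<le> \<nu>"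
  shows "\<mu> \<le> \<kappa> \<or> \<kappa> \<le> \<mu>"
proof -
  have val: "valuation \<mu>" "valuation \<kappa>" "valuation \<nu>"
    using T by (auto simp: val_tree_def)
  have main: "\<mu> \<le> \<kappa> \<or> \<kappa> \<le> \<mu>"
    if \<phi>: "separating_polynomial \<mu> \<nu> \<phi>" and "\<mu> \<le> \<nu>"
      and \<kappa>: "valuation \<kappa>" and below: "\<And>f. degree f < degree \<phi> \<Longrightarrow> \<kappa> f = \<nu> f" and "\<kappa> \<le> \<nu>"
    for \<mu> \<kappa> \<phi>
  proof -
    interpret separating_polynomial \<mu> \<nu> \<phi> by fact
    show ?thesis
    proof (cases "\<mu> \<phi> \<le> \<kappa> \<phi>")
      case True
      then have "truncation \<mu> \<phi> \<le> \<kappa>"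
        using truncation_le[OF \<kappa>] separating_polynomial.below[OF \<phi>] that(4) by (simp add: le_fun_def)
      then show ?thesis
        using truncation_eq_if_le \<open>\<mu> \<le> \<nu>\<close> by simp
    next
      case False
      \<comment> \<open>Here \<open>\<kappa> \<phi> < \<mu> \<phi> < \<nu> \<phi>\<close>, so the
        same \<open>\<phi>\<close> separates \<open>\<kappa>\<close> from \<open>\<nu>\<close>, and
        \<open>\<kappa>\<close> is its own truncation.\<close>
      then interpret \<kappa>: separating_polynomial \<kappa> \<nu> \<phi>
        using value_less degree_pos \<nu> \<kappa> that(4) by unfold_locales auto
      have "truncation \<kappa> \<phi> \<le> \<mu>"
        using \<kappa>.truncation_le[OF \<mu>] separating_polynomial.below[OF \<phi>] that(4) False
        by (simp add: le_fun_def)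
      then show ?thesis
        using \<kappa>.truncation_eq_if_le \<open>\<kappa> \<le> \<nu>\<close> by simp
    qed
  qed
  show ?thesis
  proof (cases "\<mu> = \<nu> \<or> \<kappa> = \<nu>")
    case True
    then show ?thesis using le by auto
  next
    case False
    obtain \<phi> where \<phi>: "separating_polynomial \<mu> \<nu> \<phi>"
      using val_tree_separating_polynomial_le[of \<mu> v \<nu>] T le False by blast
    obtain \<psi> where \<psi>: "separating_polynomial \<kappa> \<nu> \<psi>"
      using val_tree_separating_polynomial_le[of \<kappa> v \<nu>] T le False by blast
    show ?thesis
    proof (cases "degree \<phi> \<le> degree \<psi>")
      case True
      show ?thesis
        by (rule main[OF \<phi>]) (use True le val separating_polynomial.below[OF \<psi>] in auto)
    next
      case False
      have "\<kappa> \<le> \<mu> \<or> \<mu> \<le> \<kappa>"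
        by (rule main[OF \<psi>]) (use False le val separating_polynomial.below[OF \<phi>] in auto)
      then show ?thesis by auto
    qed
  qed
qed

text \<open>A common lower bound and \<open>\<rho>\<close> both lie below \<open>\<mu>\<close>,
  hence are comparable; if the bound lies above \<open>\<rho>\<close>, maximality makes them
  equal.\<close>

lemma val_tree_meet_separated:
  assumes \<phi>: "separating_polynomial \<mu> \<nu> \<phi>" and T: "\<mu> \<in> val_tree v"
  shows "\<exists>\<rho>\<in>val_tree v. \<rho> \<le> \<mu> \<and> \<rho> \<le> \<nu> \<and> (\<forall>\<eta>\<in>val_tree v. \<eta> \<le> \<mu> \<and> \<eta> \<le> \<nu> \<longrightarrow> \<eta> \<le> \<rho>)"
proof -
  interpret separating_polynomial \<mu> \<nu> \<phi> by fact
  have \<rho>: "\<rho> \<in> val_tree v"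
    using T valuation_truncation degree_pos by (simp add: val_tree_def truncation_below)
  have le: "\<rho> \<le> \<mu>" "\<rho> \<le> \<nu>"
    by (simp_all add: le_fun_def truncation_le_left truncation_le_right)
  have "\<eta> \<le> \<rho>" if \<eta>: "\<eta> \<in> val_tree v" "\<eta> \<le> \<mu>" "\<eta> \<le> \<nu>" for \<eta>
    using val_tree_lower_comparable[OF \<eta>(1) \<rho> T \<eta>(2) le(1)] truncation_maximal[of \<eta>] \<eta>
    by (auto simp: val_tree_def)
  then show ?thesis
    using \<rho> le by blast
qed

lemma val_tree_meet:
  assumes T: "\<mu> \<in> val_tree v" "\<nu> \<in> val_tree v"
  shows "\<exists>\<rho>\<in>val_tree v. \<rho> \<le> \<mu> \<and> \<rho> \<le> \<nu> \<and> (\<forall>\<eta>\<in>val_tree v. \<eta> \<le> \<mu> \<and> \<eta> \<le> \<nu> \<longrightarrow> \<eta> \<le> \<rho>)"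
proof (cases "\<mu> = \<nu>")
  case True
  with T(1) show ?thesis by (intro bexI[of _ \<mu>]) simp_all
next
  case False
  from val_tree_separating_polynomial[OF T False] show ?thesis
  proof cases
    case 1
    then show ?thesis by (rule val_tree_meet_separated[OF _ T(1)])
  next
    case 2
    from val_tree_meet_separated[OF 2 T(2)] show ?thesis
      by blast
  qed
qed

section \<open>Classes and tangent directions in an abstract tree with meets\<close>

locale meet_tree =
  fixes T :: "'a::order set"
  assumes lower_comparable:
      "\<lbrakk>x \<in> T; y \<in> T; z \<in> T; x \<le> z; y \<le> z\<rbrakk> \<Longrightarrow> x \<le> y \<or> y \<le> x"
    and meet_exists:
      "\<lbrakk>x \<in> T; y \<in> T\<rbrakk> \<Longrightarrow> \<exists>m\<in>T. m \<le> x \<and> m \<le> y \<and> (\<forall>z\<in>T. z \<le> x \<and> z \<le> y \<longrightarrow> z \<le> m)"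
begin

lemma inf_in:
  assumes "x \<in> T" and "y \<in> T"
  shows "inf_in T x y \<in> T" "inf_in T x y \<le> x" "inf_in T x y \<le> y"
    and inf_in_greatest: "\<And>z. \<lbrakk>z \<in> T; z \<le> x; z \<le> y\<rbrakk> \<Longrightarrow> z \<le> inf_in T x y"
proof -
  have "\<exists>!m. m \<in> T \<and> m \<le> x \<and> m \<le> y \<and> (\<forall>z\<in>T. z \<le> x \<and> z \<le> y \<longrightarrow> z \<le> m)"
    using meet_exists[OF assms] by (auto intro: antisym)
  from theI'[OF this] show "inf_in T x y \<in> T" "inf_in T x y \<le> x" "inf_in T x y \<le> y"
    "\<And>z. \<lbrakk>z \<in> T; z \<le> x; z \<le> y\<rbrakk> \<Longrightarrow> z \<le> inf_in T x y"
    unfolding inf_in_def by blast+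
qed

text \<open>If \<open>\<mu>\<close> lies below x or y, it shares an upper bound with the meet, so
  the two are comparable and avoiding the interval means lying strictly below the meet.\<close>

lemma mem_sim_rel_iff:
  assumes \<mu>: "\<mu> \<in> T" and xy: "x \<in> T - {\<mu>}" "y \<in> T - {\<mu>}"
  shows "(x, y) \<in> sim_rel T \<mu> \<longleftrightarrow> \<not> \<mu> \<le> x \<and> \<not> \<mu> \<le> y \<or> \<mu> < inf_in T x y"
proof -
  let ?m = "inf_in T x y"
  have m: "?m \<in> T" "?m \<le> x" "?m \<le> y" and greatest: "\<mu> \<le> x \<Longrightarrow> \<mu> \<le> y \<Longrightarrow> \<mu> \<le> ?m"
    using inf_in[of x y] inf_in_greatest[of x y \<mu>] xy \<mu> by auto
  have comparable: "\<mu> \<le> x \<or> \<mu> \<le> y \<Longrightarrow> \<mu> \<le> ?m \<or> ?m \<le> \<mu>"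
    using lower_comparable[of \<mu> ?m] m \<mu> xy by blast
  have "(x, y) \<in> sim_rel T \<mu> \<longleftrightarrow> \<not> (?m \<le> \<mu> \<and> (\<mu> \<le> x \<or> \<mu> \<le> y))"
    using xy \<mu> by (auto simp: sim_rel_def tree_interval_def)
  also have "\<dots> \<longleftrightarrow> \<not> \<mu> \<le> x \<and> \<not> \<mu> \<le> y \<or> \<mu> < ?m"
    using comparable by (auto simp: less_le_not_le)
  finally show ?thesis .
qed

text \<open>A common point of the two half-open intervals lies below the meet; conversely the meet
  itself is such a point.\<close>

lemma mem_tan_rel_iff:
  assumes "\<mu> \<in> T" and "x \<in> T" and "y \<in> T"
  shows "(x, y) \<in> tan_rel T \<mu> \<longleftrightarrow> \<mu> < inf_in T x y"
  using inf_in[OF assms(2,3)] inf_in_greatest[OF assms(2,3)] assms(2,3)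
  unfolding tan_rel_def left_open_interval_def
  by (auto intro: less_le_trans)

lemma sim_rel_eq:
  assumes "\<mu> \<in> T"
  shows "sim_rel T \<mu> = tan_rel T \<mu> \<union> not_above T \<mu> \<times> not_above T \<mu>"
proof -
  have "(x, y) \<in> sim_rel T \<mu> \<longleftrightarrow> (x, y) \<in> tan_rel T \<mu> \<union> not_above T \<mu> \<times> not_above T \<mu>" for x y
  proof (cases "x \<in> T - {\<mu>} \<and> y \<in> T - {\<mu>}")
    case True
    then show ?thesis
      using mem_sim_rel_iff[OF assms] mem_tan_rel_iff[OF assms] by (auto simp: not_above_def)
  next
    case False
    then show ?thesis
      by (auto simp: sim_rel_def tan_rel_def not_above_def)
  qed
  then show ?thesis by auto
qed

text \<open>The relation splits into blocks on the disjoint sets \<open>?A\<close> and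
  \<open>?B\<close>, so classes can be computed separately. The second block is a full square and
  gives one class, provided it is nonempty.\<close>

lemma sim_classes_eq:
  assumes \<mu>: "\<mu> \<in> T" and ne: "not_above T \<mu> \<noteq> {}"
  shows "sim_classes T \<mu> = tangent_directions T \<mu> \<union> {not_above T \<mu>}"
proof -
  let ?A = "{x \<in> T. \<mu> < x}" and ?B = "not_above T \<mu>"
  have "T - {\<mu>} = ?A \<union> ?B"
    using \<mu> by (auto simp: not_above_def less_le)
  moreover have "sim_rel T \<mu> `` {x} = tan_rel T \<mu> `` {x}" if "x \<in> ?A" for x
    using that by (auto simp: sim_rel_eq[OF \<mu>] not_above_def)
  moreover have "sim_rel T \<mu> `` {x} = ?B" if "x \<in> ?B" for x
    using that by (auto simp: sim_rel_eq[OF \<mu>] tan_rel_def not_above_def)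
  ultimately show ?thesis
    using ne by (auto simp: sim_classes_def tangent_directions_def quotient_def)
qed

text \<open>A tangent direction contains its representative, which is above
  \<open>\<mu>\<close>.\<close>

lemma not_above_notin_tangent_directions: "not_above T \<mu> \<notin> tangent_directions T \<mu>"
proof
  assume "not_above T \<mu> \<in> tangent_directions T \<mu>"
  then obtain x where "x \<in> T" "\<mu> < x" and eq: "not_above T \<mu> = tan_rel T \<mu> `` {x}"
    by (auto simp: tangent_directions_def quotient_def)
  then have "x \<in> tan_rel T \<mu> `` {x}"
    by (auto simp: tan_rel_def left_open_interval_def)
  with eq have "x \<in> not_above T \<mu>"
    by simp
  with \<open>\<mu> < x\<close> show False
    by (simp add: not_above_def less_imp_le)
qed

end

lemma meet_tree_val_tree: "meet_tree (val_tree v)"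
  by unfold_locales (use val_tree_lower_comparable val_tree_meet in blast)+

theorem proposition4p9:
  fixes v :: "'k::field \<Rightarrow> 'l::linordered_ab_group_add with_infty"
    and \<Gamma>\<^sub>Q :: "'l set"
    and \<mu> :: "'k poly \<Rightarrow> 'l with_infty"
  assumes "valuation v"
    and "is_divisible_hull (value_group v) \<Gamma>\<^sub>Q"
    and "\<mu> \<in> val_tree v"
    and "\<exists>\<eta>\<in>val_tree v. \<not> \<mu> \<le> \<eta>"
  shows "sim_classes (val_tree v) \<mu> =
           tangent_directions (val_tree v) \<mu> \<union> {not_above (val_tree v) \<mu>} \<and>
         tangent_directions (val_tree v) \<mu> \<inter> {not_above (val_tree v) \<mu>} = {}"
proof -
  interpret meet_tree "val_tree v"
    by (rule meet_tree_val_tree)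
  have "not_above (val_tree v) \<mu> \<noteq> {}"
    using assms(4) by (auto simp: not_above_def)
  then show ?thesis
    using sim_classes_eq[OF assms(3)] not_above_notin_tangent_directions by simp
qed

end
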